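(* Let $d\ge2$, let $(r_n)$ be a sequence of positive numbers decreasing to $0$, and let $(\delta_n)$, $(\alpha_n)$ be sequences in $(0,1)$ tending to $0$, with $(\delta_n)$ decreasing. Assume that for $n\ge 2$ $$\frac{c\,\sqrt{n}\; r_n^d\,\delta_n\,\alpha_n^{d-1}}{\log n}\ \ge\ 2 ,$$ where $c=c(d)>0$ is the constant described in the context. Then, $\mathbb{P}$-almost surely, there exists $n_0$, depending on the realization, such that for all $n\ge n_0$ every set of $\mathcal{A}_n$ contains a point of $\chi_n$. Hence, for all $n\ge n_0$ and every $x\in\mathcal{C}_n$, $\mathcal{N}_x^{\delta_n}$ contains points in all directions, i.e. for every rotation $R$ of $\mathbb{R}^d$ such that $x+R\,S(r_n,\delta_n,\alpha_n)\subset[0,1]^d$, the set $x+R\,S(r_n,\delta_n,\alpha_n)$ contains a point of $\mathcal{N}_x^{\delta_n}$. In particular, $\mathcal{N}_x^{\delta_n}\neq\emptyset$ for all $x\in\mathcal{C}_n$ and all $n\ge n_0$.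
   Context: $(X_n)_{n\in\mathbb{N}}$ are independent random variables uniform on $[0,1]^d$; $\mathbb{P}$ is the product measure on $\Omega=([0,1]^d)^{\mathbb{N}}$. Set $\chi_n=\{X_1,\dots,X_n\}$. The graph $\mathcal{G}_n$ has vertex set $\chi_n$, and distinct $x,y\in\chi_n$ are adjacent ($x\sim y$) iff $|x-y|<r_n$ (Euclidean norm). $\mathcal{C}_n$ denotes the largest connected component of $\mathcal{G}_n$ (its vertex set). For $x\in\chi_n$, $\mathcal{N}_x=\{y\in\chi_n: y\sim x\}$ and $\mathcal{N}_x^{\delta_n}=\{y\in\mathcal{N}_x: |x-y|>(1-\delta_n)r_n\}$. For $r>0$, $\delta\in(0,1)$, $\alpha>0$ let $S(r,\delta)=\{z\in\mathbb{R}^d: r(1-\delta)<|z|<r\}$, $K(\alpha)=\{z\in\mathbb{R}^d: \sqrt{z_1^2+\dots+z_{d-1}^2}\le\alpha z_d\}$, and $S(r,\delta,\alpha)=S(r,\delta)\cap K(\alpha)$. $\mathcal{A}_n$ is the collection of all sets obtained by applying rotations and translations by vectors of $\mathbb{Q}^d$ to $S(r_n,\delta_n,\alpha_n)$ (i.e. sets $q+R\,S(r_n,\delta_n,\alpha_n)$ with $q\in\mathbb{Q}^d$ and $R$ a rotation) that are contained in $[0,1]^d$. All elements of $\mathcal{A}_n$ have the same Lebesgue measure, which is asymptotic to $c\,r_n^d\delta_n\alpha_n^{d-1}$ as $\delta_n,\alpha_n\to0$, with $c>0$ depending only on $d$; this is the constant $c$ in the claim. *)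

theory Defs
  imports "HOL-Probability.Probability" "HOL-Library.Landau_Symbols"
begin

text \<open>
  The space \<open>\<real>\<^sup>d\<close> is \<open>real ^ 'd\<close>, where the order on the index type \<open>'d\<close> only serves to
  single out a last coordinate.
\<close>

definition unit_cube :: "(real ^ 'd) set" where
  "unit_cube = cbox 0 1"

text \<open>
  The sample space is \<open>([0,1]\<^sup>d)\<^sup>\<nat>\<close> with \<open>\<nat> = {1, 2, \<dots>}\<close>; the random variable \<open>X\<^sub>n\<close> is the
  coordinate projection \<open>\<lambda>\<omega>. \<omega> n\<close>. The cube has volume 1, so Lebesgue measure restricted to it
  is the uniform distribution.
\<close>

definition sample_space :: "(nat \<Rightarrow> real ^ 'd) measure" where
  "sample_space = PiM {1..} (\<lambda>_. restrict_space lborel unit_cube)"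

definition sample_points :: "nat \<Rightarrow> (nat \<Rightarrow> 'a) \<Rightarrow> 'a set" where
  "sample_points n \<omega> = \<omega> ` {1..n}"


definition geom_edges :: "real \<Rightarrow> 'a::metric_space set \<Rightarrow> ('a \<times> 'a) set" where
  "geom_edges r V = {(x, y). x \<in> V \<and> y \<in> V \<and> x \<noteq> y \<and> dist x y < r}"

definition geom_components :: "real \<Rightarrow> 'a::metric_space set \<Rightarrow> 'a set set" where
  "geom_components r V = {(geom_edges r V)\<^sup>* `` {x} | x. x \<in> V}"

text \<open>
  The maximum number of vertices may be attained by several components; each of them counts as
  a largest one.
\<close>

definition largest_component :: "real \<Rightarrow> 'a::metric_space set \<Rightarrow> 'a set \<Rightarrow> bool" where
  "largest_component r V = is_arg_max card (\<lambda>C. C \<in> geom_components r V)"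

definition neighbours :: "real \<Rightarrow> 'a::metric_space set \<Rightarrow> 'a \<Rightarrow> 'a set" where
  "neighbours r V x = {y \<in> V. (x, y) \<in> geom_edges r V}"

definition outer_neighbours :: "real \<Rightarrow> real \<Rightarrow> 'a::metric_space set \<Rightarrow> 'a \<Rightarrow> 'a set" where
  "outer_neighbours r \<delta> V x = {y \<in> neighbours r V x. dist x y > (1 - \<delta>) * r}"


definition last_coord :: "'d::{finite,linorder}" where
  "last_coord = Max UNIV"

definition shell :: "real \<Rightarrow> real \<Rightarrow> 'a::real_normed_vector set" where
  "shell r \<delta> = {z. r * (1 - \<delta>) < norm z \<and> norm z < r}"

definition upward_cone :: "real \<Rightarrow> (real ^ 'd::{finite,linorder}) set" where
  "upward_cone \<alpha> = {z. sqrt (\<Sum>i\<in>UNIV - {last_coord}. (z $ i)\<^sup>2) \<le> \<alpha> * z $ last_coord}"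

definition shell_sector :: "real \<Rightarrow> real \<Rightarrow> real \<Rightarrow> (real ^ 'd::{finite,linorder}) set" where
  "shell_sector r \<delta> \<alpha> = shell r \<delta> \<inter> upward_cone \<alpha>"

definition moved_sector ::
    "real \<Rightarrow> real \<Rightarrow> real \<Rightarrow> real ^ 'd::{finite,linorder} \<Rightarrow>
       real ^ 'd::{finite,linorder} ^ 'd::{finite,linorder} \<Rightarrow> (real ^ 'd::{finite,linorder}) set" where
  "moved_sector r \<delta> \<alpha> q R = (\<lambda>z. q + R *v z) ` shell_sector r \<delta> \<alpha>"

definition sector_family ::
    "real \<Rightarrow> real \<Rightarrow> real \<Rightarrow> (real ^ 'd::{finite,linorder}) set set" where
  "sector_family r \<delta> \<alpha> =
     {moved_sector r \<delta> \<alpha> q R | q R.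
        (\<forall>i. q $ i \<in> \<rat>) \<and> rotation_matrix R \<and> moved_sector r \<delta> \<alpha> q R \<subseteq> unit_cube}"

text \<open>
  The unique \<open>c > 0\<close> such that the volume of \<open>shell_sector r \<delta> \<alpha>\<close> is asymptotic to
  \<open>c * r ^ d * \<delta> * \<alpha> ^ (d - 1)\<close>, as \<open>\<delta>\<close> and \<open>\<alpha>\<close> tend to 0 independently; its value is the
  volume of the unit ball of dimension \<open>d - 1\<close>.
\<close>

definition sector_const :: "'d::{finite,linorder} itself \<Rightarrow> real" where
  "sector_const _ = (THE c. c > 0 \<and>
     (\<forall>r>0. (\<lambda>(\<delta>, \<alpha>). measure lborel (shell_sector r \<delta> \<alpha> :: (real ^ 'd::{finite,linorder}) set))
        \<sim>[at_right 0 \<times>\<^sub>F at_right 0]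
        (\<lambda>(\<delta>, \<alpha>). c * r ^ CARD('d) * \<delta> * \<alpha> ^ (CARD('d) - 1))))"

end

theory Submission
  imports Defs
begin

text \<open>
  The expected number of sample points in a sector grows at least like a multiple of
  \<open>sqrt n * ln n\<close>, so a given sector is empty with probability at most
  \<open>exp (- c * sqrt n * ln n)\<close>. This beats every polynomial, so constants do not matter and a union
  bound over polynomially many sectors is affordable. Rounding the entries of a centre and a
  rotation matrix to a grid of mesh \<open>1 / n\<close> gives such a finite net: the growth condition forces
  \<open>r * \<delta> * \<alpha>\<close> to be much larger than \<open>1 / n\<close>, hence every moved sector with arbitrary real centre
  contains a slightly smaller sector moved by an element of the net. The claims follow by
  Borel-Cantelli. Any point of the cube admits a rotation that keeps its sector inside the cube: turn
  the axis of the cone to the diagonal direction of the orthant that contains the farthest vertex.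
\<close>

section \<open>Volume of open sets under orthogonal maps\<close>

text \<open>
  The library's \<open>measure_orthogonal_image\<close> needs a well-ordered index type, whereas the sort of
  \<open>'d\<close> is only \<open>{finite,linorder}\<close>. For open sets a Vitali covering by balls suffices.
\<close>

lemma emeasure_open_le_orthogonal_image:
  fixes f :: "'a::euclidean_space \<Rightarrow> 'a"
  assumes f: "orthogonal_transformation f" and U: "open U"
  shows "emeasure lborel U \<le> emeasure lborel (f ` U)"
proof -
  define K where "K = {p :: 'a \<times> real. 0 < snd p \<and> ball (fst p) (snd p) \<subseteq> U}"
  \<comment> \<open>Every point of \<open>U\<close> is the centre of arbitrarily small balls inside
    \<open>U\<close>, which is the fineness condition of Vitali's theorem.\<close>
  have small: "\<exists>p. p \<in> K \<and> x \<in> ball (fst p) (snd p) \<and> snd p < d" if "x \<in> U" "0 < d" for x d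
  proof -
    obtain e where e: "e > 0" "ball x e \<subseteq> U"
      using U \<open>x \<in> U\<close> openE by blast
    have "ball x (min e (d/2)) \<subseteq> U"
      using e by (auto simp: subset_iff)
    then show ?thesis
      using e \<open>0 < d\<close> by (intro exI[of _ "(x, min e (d/2))"]) (auto simp: K_def)
  qed
  obtain C where C: "countable C" "C \<subseteq> K"
    and disj: "pairwise (\<lambda>i j. disjnt (ball (fst i) (snd i)) (ball (fst j) (snd j))) C"
    and neg: "negligible (U - (\<Union>i\<in>C. ball (fst i) (snd i)))"
    using Vitali_covering_theorem_balls[of U K fst snd, OF small] by blast
  let ?B = "\<lambda>p. ball (fst p) (snd p)"
  \<comment> \<open>An orthogonal map sends a ball to a ball of the same radius, hence of the same
    volume, and injectivity keeps the images disjoint. So \<open>U\<close> and its image can be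
    compared ball by ball.\<close>
  have fB: "f ` ?B p = ball (f (fst p)) (snd p)" for p
    using f by (simp add: image_orthogonal_transformation_ball)
  have inj: "inj f"
    using f by (simp add: orthogonal_transformation_inj)
  have df: "disjoint_family_on ?B C"
    using disj by (auto simp: disjoint_family_on_def pairwise_def disjnt_def)
  then have df': "disjoint_family_on (\<lambda>p. f ` ?B p) C"
    using inj by (simp add: disjoint_family_on_def image_Int[symmetric])
  have Bsub: "(\<Union>p\<in>C. ?B p) \<subseteq> U"
    using C by (auto simp: K_def)
  have openB: "open (\<Union>p\<in>C. ?B p)"
    by auto
  have "emeasure lborel U = emeasure lebesgue U"
    using U by simp
  \<comment> \<open>The part of \<open>U\<close> outside the balls is negligible: it is adjoined to
    obtain a cover of \<open>U\<close> and then drops out.\<close>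
  also have "\<dots> \<le> emeasure lebesgue ((\<Union>p\<in>C. ?B p) \<union> (U - (\<Union>p\<in>C. ?B p)))"
  proof (intro emeasure_mono)
    have "open ((\<Union>p\<in>C. ?B p) \<union> U)"
      using U by auto
    then show "(\<Union>p\<in>C. ?B p) \<union> (U - (\<Union>p\<in>C. ?B p)) \<in> sets lebesgue"
      by (simp add: borel_open)
  qed auto
  also have "\<dots> = emeasure lebesgue (\<Union>p\<in>C. ?B p)"
  proof (intro emeasure_Un_null_set)
    show "(\<Union>p\<in>C. ?B p) \<in> sets lebesgue"
      using openB by (simp add: borel_open)
  qed (use neg in \<open>simp add: negligible_iff_null_sets\<close>)
  also have "\<dots> = emeasure lborel (\<Union>p\<in>C. ?B p)"
    using openB by simp
  also have "\<dots> = (\<integral>\<^sup>+p. emeasure lborel (?B p) \<partial>count_space C)"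
    using C df by (intro emeasure_UN_countable) auto
  also have "\<dots> = (\<integral>\<^sup>+p. emeasure lborel (f ` ?B p) \<partial>count_space C)"
  proof (intro nn_integral_cong)
    fix p assume "p \<in> space (count_space C)"
    then have "0 \<le> snd p"
      using C by (auto simp: K_def)
    then show "emeasure lborel (?B p) = emeasure lborel (f ` ?B p)"
      by (simp add: fB emeasure_ball)
  qed
  also have "\<dots> = emeasure lborel (\<Union>p\<in>C. f ` ?B p)"
    using C df' by (intro emeasure_UN_countable[symmetric]) (auto simp: fB)
  also have "\<dots> \<le> emeasure lborel (f ` U)"
  proof (intro emeasure_mono)
    have "open (f ` U)"
      using U f inj by (intro open_surjective_linear_image)
        (auto simp: orthogonal_transformation_linear orthogonal_transformation_surj)
    then show "f ` U \<in> sets lborel"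
      by simp
  qed (use Bsub in auto)
  finally show ?thesis .
qed

section \<open>Geometry of the cone and of the shrunken sector\<close>

text \<open>The distance from \<open>z\<close> to the axis of the cone. Writing it with
  \<open>L2_set\<close> gives the square root in \<open>upward_cone_def\<close> a triangle
  inequality.\<close>

definition transverse_norm :: "real ^ 'd::{finite,linorder} \<Rightarrow> real" where
  "transverse_norm z = L2_set (\<lambda>i. z $ i) (UNIV - {last_coord})"

lemma upward_cone_iff: "z \<in> upward_cone \<alpha> \<longleftrightarrow> transverse_norm z \<le> \<alpha> * z $ last_coord"
  by (simp add: upward_cone_def transverse_norm_def L2_set_def)

lemma transverse_norm_nonneg: "0 \<le> transverse_norm z"
  by (simp add: transverse_norm_def)

lemma transverse_norm_le_norm: "transverse_norm z \<le> norm z"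
  unfolding transverse_norm_def norm_vec_def L2_set_def
  by (auto intro!: real_sqrt_le_mono sum_mono2)

lemma transverse_norm_triangle: "transverse_norm (x + y) \<le> transverse_norm x + transverse_norm y"
  by (simp add: transverse_norm_def L2_set_triangle_ineq)

lemma transverse_norm_scaleR: "transverse_norm (c *\<^sub>R z) = \<bar>c\<bar> * transverse_norm z"
  by (simp add: transverse_norm_def L2_set_def power_mult_distrib real_sqrt_mult
      flip: sum_distrib_left)

text \<open>Pythagoras with a nonnegative mixed term. Inside a cone it bounds the height
  \<open>z $ last_coord\<close> from below by a multiple of the norm.\<close>

lemma norm_le_transverse_norm_plus: "norm z \<le> transverse_norm z + \<bar>z $ last_coord\<bar>"
proof -
  have "(norm z)\<^sup>2 = (\<Sum>i\<in>UNIV. (z $ i)\<^sup>2)"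
    by (simp add: norm_vec_def L2_set_def sum_nonneg)
  also have "\<dots> = (z $ last_coord)\<^sup>2 + (\<Sum>i\<in>UNIV - {last_coord}. (z $ i)\<^sup>2)"
    by (subst sum.remove[of _ last_coord]) auto
  also have "\<dots> = (transverse_norm z)\<^sup>2 + \<bar>z $ last_coord\<bar>\<^sup>2"
    by (simp add: transverse_norm_def L2_set_def sum_nonneg)
  also have "\<dots> \<le> (transverse_norm z + \<bar>z $ last_coord\<bar>)\<^sup>2"
    by (simp add: power2_sum transverse_norm_nonneg)
  finally show ?thesis
    by (rule power2_le_imp_le) (simp add: transverse_norm_nonneg)
qed

lemma continuous_on_transverse_norm [continuous_intros]:
  "continuous_on S f \<Longrightarrow> continuous_on S (\<lambda>x. transverse_norm (f x))"
  unfolding transverse_norm_def L2_set_def by (intro continuous_intros)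

text \<open>
  An open subset of the sector with comparable volume, which stays inside the sector under
  displacements of length at most \<open>r * \<delta> * \<alpha> / 32\<close>.
\<close>

definition inner_sector :: "real \<Rightarrow> real \<Rightarrow> real \<Rightarrow> (real ^ 'd::{finite,linorder}) set" where
  "inner_sector r \<delta> \<alpha> = {z. r * (1 - 3 * \<delta> / 4) < norm z \<and> norm z < r * (1 - \<delta> / 4) \<and>
     transverse_norm z < \<alpha> / 2 * z $ last_coord}"

lemma open_inner_sector: "open (inner_sector r \<delta> \<alpha>)"
  unfolding inner_sector_def
  by (intro open_Collect_conj open_Collect_less continuous_intros continuous_on_component)

text \<open>The displacement is at most both r\<delta>/32 and r\<alpha>/32. The first fits into the
  radial slack r\<delta>/4 on either side. For the second, the height of \<open>z\<close> is at
  least r/6, so halving the aperture leaves a transverse slack of at least r\<alpha>/12, more than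
  twice the displacement.\<close>

lemma inner_sector_perturb:
  assumes r: "0 < r" and \<delta>: "0 < \<delta>" "\<delta> < 1" and \<alpha>: "0 < \<alpha>" "\<alpha> < 1"
    and z: "z \<in> inner_sector r \<delta> \<alpha>" and wz: "norm (w - z) \<le> r * \<delta> * \<alpha> / 32"
  shows "w \<in> shell_sector r \<delta> \<alpha>"
proof -
  let ?e = "r * \<delta> * \<alpha> / 32"
  have e1: "?e \<le> r * \<delta> / 32" "?e \<le> r * \<alpha> / 32"
    using assms by (auto simp: mult_le_cancel_left mult_le_cancel_right)
  have rd: "0 < r * \<delta>" "r * \<delta> < r" "0 < r * \<alpha>"
    using assms by auto
  have nz: "r - 3 * (r * \<delta>) / 4 < norm z" "norm z < r - r * \<delta> / 4"
    using z by (auto simp: inner_sector_def algebra_simps)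
  have w: "norm z - norm (w - z) \<le> norm w" "norm w \<le> norm z + norm (w - z)"
    using norm_triangle_ineq2[of z w] norm_triangle_ineq[of z "w - z"]
    by (auto simp: norm_minus_commute)
  have "w \<in> shell r \<delta>"
    using nz w e1 wz rd by (auto simp: shell_def algebra_simps)
  moreover have "w \<in> upward_cone \<alpha>"
  proof -
    let ?l = "last_coord"
    have hz: "transverse_norm z < \<alpha> / 2 * z $ ?l"
      using z by (simp add: inner_sector_def)
    then have "0 < \<alpha> / 2 * z $ ?l"
      using transverse_norm_nonneg[of z] by linarith
    then have zl: "0 < z $ ?l"
      using \<alpha> by (simp add: zero_less_mult_iff)
    have az: "\<alpha> * z $ ?l < z $ ?l"
      using \<alpha> zl by simp
    \<comment> \<open>As \<delta> < 1, the inner radius exceeds r/4; as \<alpha> < 1, the transverse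
      norm is below half the height. Together they force the height to be at least r/6.\<close>
    have "r / 4 < norm z"
      using nz rd by linarith
    also have "\<dots> \<le> 3 / 2 * z $ ?l"
      using norm_le_transverse_norm_plus[of z] hz az zl by linarith
    finally have "r / 6 \<le> z $ ?l"
      by simp
    then have "\<alpha> * (r / 6) \<le> \<alpha> * z $ ?l"
      using \<alpha> by simp
    then have raz: "r * \<alpha> / 6 \<le> \<alpha> * z $ ?l"
      by (simp add: mult.commute)
    have "\<bar>(w - z) $ ?l\<bar> \<le> norm (w - z)"
      by (rule component_le_norm_cart)
    then have wl: "z $ ?l - ?e \<le> w $ ?l"
      using wz by simp
    have "\<alpha> * ?e \<le> 1 * ?e"
      using assms by (intro mult_right_mono) auto
    moreover have "\<alpha> * (z $ ?l - ?e) \<le> \<alpha> * w $ ?l"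
      using wl \<alpha> by (intro mult_left_mono) auto
    ultimately have "\<alpha> * z $ ?l - ?e \<le> \<alpha> * w $ ?l"
      by (simp add: right_diff_distrib)
    moreover have "transverse_norm w \<le> transverse_norm z + ?e"
      using transverse_norm_triangle[of z "w - z"] transverse_norm_le_norm[of "w - z"] wz by simp
    ultimately show ?thesis
      using hz raz e1 rd unfolding upward_cone_iff by linarith
  qed
  ultimately show ?thesis
    by (simp add: shell_sector_def)
qed

section \<open>Lower bound for the volume of the shrunken sector\<close>

text \<open>Without an inner radius the set is exactly homogeneous in \<rho>, so the volume of a
  piece of shell is a difference of two such volumes. Strict inequalities make it open.\<close>

definition cone_ball :: "real \<Rightarrow> real \<Rightarrow> (real ^ 'd::{finite,linorder}) set" where
  "cone_ball \<rho> \<beta> = {z. norm z < \<rho> \<and> transverse_norm z < \<beta> * z $ last_coord}"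

lemma open_cone_ball: "open (cone_ball \<rho> \<beta>)"
  unfolding cone_ball_def
  by (intro open_Collect_conj open_Collect_less continuous_intros continuous_on_component)

lemma bounded_cone_ball: "bounded (cone_ball \<rho> \<beta>)"
  by (rule bounded_subset[OF bounded_ball[of 0 \<rho>]]) (auto simp: cone_ball_def)

lemma lmeasurable_cone_ball: "cone_ball \<rho> \<beta> \<in> lmeasurable"
  by (simp add: bounded_cone_ball lmeasurable_open open_cone_ball)

text \<open>The summand \<open>0\<close> gives the dilation the affine form to which
  \<open>measure_lebesgue_affine\<close> applies.\<close>

lemma cone_ball_scale:
  assumes "0 < \<rho>"
  shows "cone_ball \<rho> \<beta> = (\<lambda>z. \<rho> *\<^sub>R z + 0) ` cone_ball 1 \<beta>"
proof (intro subset_antisym subsetI)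
  fix z :: "real ^ 'a::{finite,linorder}" assume "z \<in> cone_ball \<rho> \<beta>"
  then have "z /\<^sub>R \<rho> \<in> cone_ball 1 \<beta>"
    using assms by (simp add: cone_ball_def transverse_norm_scaleR field_simps)
  then show "z \<in> (\<lambda>z. \<rho> *\<^sub>R z + 0) ` cone_ball 1 \<beta>"
    using assms by (intro image_eqI[of _ _ "z /\<^sub>R \<rho>"]) auto
qed (use assms in \<open>auto simp: cone_ball_def transverse_norm_scaleR field_simps\<close>)

lemma measure_cone_ball:
  assumes "0 < \<rho>"
  shows "measure lebesgue (cone_ball \<rho> \<beta> :: (real ^ 'd::{finite,linorder}) set) =
    \<rho> ^ CARD('d) * measure lebesgue (cone_ball 1 \<beta> :: (real ^ 'd::{finite,linorder}) set)"
  unfolding cone_ball_scale[OF assms] measure_lebesgue_affine using assms by simp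

text \<open>A box is inscribed: heights run from 1/4 to 3/8, the other coordinates from 0 to
  \<beta>/(8d). The transverse norm is then at most \<beta>/8, while the cone allows at least
  \<beta>/4 at these heights.\<close>

lemma measure_unit_cone_ball_ge:
  assumes \<beta>: "0 < \<beta>" "\<beta> < 1"
  shows "(\<beta> / (8 * real CARD('d))) ^ (CARD('d) - 1) / 8 \<le>
    measure lebesgue (cone_ball 1 \<beta> :: (real ^ 'd::{finite,linorder}) set)"
proof -
  let ?D = "real CARD('d)"
  define a b :: "real ^ 'd::{finite,linorder}" where "a = (\<chi> i. if i = last_coord then 1 / 4 else 0)"
    and "b = (\<chi> i. if i = last_coord then 3 / 8 else \<beta> / (8 * ?D))"
  have ab: "a $ i \<le> b $ i" for i
    using \<beta> by (simp add: a_def b_def)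
  have sub: "cbox a b \<subseteq> cone_ball 1 \<beta>"
  proof
    fix z assume "z \<in> cbox a b"
    then have z: "a $ i \<le> z $ i" "z $ i \<le> b $ i" for i
      by (auto simp: mem_box_cart)
    have zl: "1 / 4 \<le> z $ last_coord" "z $ last_coord \<le> 3 / 8"
      using z[of last_coord] by (auto simp: a_def b_def)
    have "transverse_norm z \<le> (\<Sum>i\<in>UNIV - {last_coord}. \<bar>z $ i\<bar>)"
      unfolding transverse_norm_def by (rule L2_set_le_sum_abs)
    also have "\<dots> \<le> (\<Sum>i\<in>UNIV - {last_coord :: 'd}. \<beta> / (8 * ?D))"
    proof (rule sum_mono)
      fix i :: 'd assume "i \<in> UNIV - {last_coord}"
      then show "\<bar>z $ i\<bar> \<le> \<beta> / (8 * ?D)"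
        using z[of i] by (auto simp: a_def b_def)
    qed
    also have "\<dots> \<le> (\<Sum>i\<in>(UNIV :: 'd set). \<beta> / (8 * ?D))"
      using \<beta> by (intro sum_mono2) auto
    also have "\<dots> = \<beta> / 8"
      by simp
    finally have tz: "transverse_norm z \<le> \<beta> / 8" .
    have "\<beta> * (1 / 4) \<le> \<beta> * z $ last_coord"
      using zl \<beta> by (intro mult_left_mono) auto
    then have "transverse_norm z < \<beta> * z $ last_coord"
      using tz \<beta> by linarith
    then show "z \<in> cone_ball 1 \<beta>"
      using tz zl \<beta> norm_le_transverse_norm_plus[of z] by (simp add: cone_ball_def)
  qed
  have "(\<beta> / (8 * ?D)) ^ (CARD('d) - 1) / 8 =
      (b $ last_coord - a $ last_coord) * (\<Prod>i\<in>UNIV - {last_coord :: 'd}. b $ i - a $ i)"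
    by (simp add: a_def b_def card_Diff_singleton)
  also have "\<dots> = (\<Prod>i\<in>UNIV. b $ i - a $ i)"
    by (rule prod.remove[symmetric]) auto
  also have "\<dots> = measure lborel (cbox a b)"
    using ab by (subst content_cbox_cart) (auto simp: interval_ne_empty_cart)
  also have "\<dots> = measure lebesgue (cbox a b)"
    by simp
  also have "\<dots> \<le> measure lebesgue (cone_ball 1 \<beta> :: (real ^ 'd::{finite,linorder}) set)"
    by (intro measure_mono_fmeasurable sub lmeasurable_cone_ball) auto
  finally show ?thesis .
qed

text \<open>The difference of two cone balls of radii \<open>p < q\<close> lies in the sector, and
  by homogeneity its volume is q^d - p^d times that of the unit cone ball. The resulting constant
  depends only on the dimension.\<close>

lemma emeasure_inner_sector_ge:
  obtains c where "0 < c" "\<And>r \<delta> \<alpha>. 0 < r \<Longrightarrow> 0 < \<delta> \<Longrightarrow> \<delta> < 1 \<Longrightarrow> 0 < \<alpha> \<Longrightarrow> \<alpha> < 1 \<Longrightarrow>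
    ennreal (c * r ^ CARD('d) * \<delta> * \<alpha> ^ (CARD('d) - 1)) \<le>
      emeasure lborel (inner_sector r \<delta> \<alpha> :: (real ^ 'd::{finite,linorder}) set)"
proof -
  let ?d = "CARD('d)"
  \<comment> \<open>The bound for the unit cone ball at aperture \<alpha>/2; the halving turns 8
    into 16.\<close>
  define k where "k = (1 / (16 * real ?d)) ^ (?d - 1) / 8"
  define c where "c = (3 / 4) ^ (?d - 1) / 4 * k"
  have "0 < k" "0 < c"
    by (simp_all add: c_def k_def)
  show thesis
  proof (rule that[OF \<open>0 < c\<close>])
    fix r \<delta> \<alpha> :: real
    assume r: "0 < r" and \<delta>: "0 < \<delta>" "\<delta> < 1" and \<alpha>: "0 < \<alpha>" "\<alpha> < 1"
    \<comment> \<open>\<open>q\<close> is the outer radius of \<open>inner_sector\<close>.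
      \<open>p\<close> lies strictly above its inner radius, so that \<open>p \<le> norm z\<close>
      implies the strict inequality required there.\<close>
    define p q where "p = r * (1 - \<delta> / 2)" and "q = r * (1 - \<delta> / 4)"
    let ?S = "inner_sector r \<delta> \<alpha> :: (real ^ 'd::{finite,linorder}) set"
    let ?U = "\<lambda>\<rho>. cone_ball \<rho> (\<alpha> / 2) :: (real ^ 'd::{finite,linorder}) set"
    have rd: "0 < r * \<delta>" "r * \<delta> < r"
      using r \<delta> by auto
    have pq_eq: "p = r - r * \<delta> / 2" "q = r - r * \<delta> / 4"
      by (simp_all add: p_def q_def algebra_simps)
    then have pq: "0 < p" "p < q" "3 / 4 * r \<le> q" "q - p = r * \<delta> / 4"
      using rd by linarith+
    have U1: "k * \<alpha> ^ (?d - 1) \<le> measure lebesgue (?U 1)"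
      using measure_unit_cone_ball_ge[of "\<alpha> / 2", where 'd = 'd] \<alpha>
      by (simp add: k_def power_divide power_mult_distrib)
    have S_bdd: "bounded ?S"
      by (rule bounded_subset[OF bounded_ball[of 0 q]]) (auto simp: inner_sector_def q_def)
    have S: "?S \<in> lmeasurable"
      using S_bdd open_inner_sector by (rule lmeasurable_open)
    \<comment> \<open>The factors 1/4 and (3/4)^(d-1) of \<open>c\<close> come from the thickness q
      - p = r\<delta>/4 and from q \<ge> 3r/4.\<close>
    have "(r * \<delta> / 4) * (3 / 4 * r) ^ (?d - 1) \<le> (q - p) * q ^ (?d - 1)"
      using pq r rd by (intro mult_mono power_mono) auto
    also have "\<dots> \<le> q ^ ?d - p ^ ?d"
    proof -
      have "p * p ^ (?d - 1) \<le> p * q ^ (?d - 1)"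
        using pq by (intro mult_left_mono power_mono) auto
      moreover have "x ^ ?d = x * x ^ (?d - 1)" for x :: real
        by (cases ?d) auto
      ultimately show ?thesis
        by (simp add: left_diff_distrib)
    qed
    finally have qp: "(r * \<delta> / 4) * (3 / 4 * r) ^ (?d - 1) \<le> q ^ ?d - p ^ ?d" .
    have rpow: "r ^ ?d = r * r ^ (?d - 1)"
      by (cases ?d) auto
    have "c * r ^ ?d * \<delta> * \<alpha> ^ (?d - 1) =
        ((r * \<delta> / 4) * (3 / 4 * r) ^ (?d - 1)) * (k * \<alpha> ^ (?d - 1))"
      unfolding c_def rpow power_mult_distrib by simp
    also have "\<dots> \<le> (q ^ ?d - p ^ ?d) * measure lebesgue (?U 1)"
    proof (rule mult_mono[OF qp U1])
      show "0 \<le> q ^ ?d - p ^ ?d"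
        using power_mono[of p q ?d] pq by simp
    qed (use \<alpha> \<open>0 < k\<close> in simp)
    also have "\<dots> = measure lebesgue (?U q) - measure lebesgue (?U p)"
      using pq by (simp add: measure_cone_ball[of p] measure_cone_ball[of q] left_diff_distrib)
    also have "\<dots> = measure lebesgue (?U q - ?U p)"
      using pq by (intro measurable_measure_Diff[symmetric] lmeasurable_cone_ball
          fmeasurableD) (auto simp: cone_ball_def)
    also have "\<dots> \<le> measure lebesgue ?S"
    proof (intro measure_mono_fmeasurable S)
      show "?U q - ?U p \<subseteq> ?S"
      proof
        fix z assume "z \<in> ?U q - ?U p"
        then have "norm z < q" "p \<le> norm z" "transverse_norm z < \<alpha> / 2 * z $ last_coord"
          by (auto simp: cone_ball_def)
        then show "z \<in> ?S"
          using pq rd by (auto simp: inner_sector_def q_def pq_eq algebra_simps)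
      qed
    qed (auto intro!: sets.Diff fmeasurableD lmeasurable_cone_ball)
    finally have "ennreal (c * r ^ ?d * \<delta> * \<alpha> ^ (?d - 1)) \<le> emeasure lebesgue ?S"
      using S by (simp add: emeasure_eq_measure2 ennreal_leI)
    then show "ennreal (c * r ^ ?d * \<delta> * \<alpha> ^ (?d - 1)) \<le> emeasure lborel ?S"
      by (simp add: borel_open open_inner_sector)
  qed
qed

section \<open>Rigid motions: volume and stability under perturbation\<close>

lemma emeasure_open_le_rigid_image:
  fixes R :: "real ^ 'n ^ 'n"
  assumes R: "orthogonal_matrix R" and U: "open U"
  shows "emeasure lborel U \<le> emeasure lborel ((\<lambda>z. q + R *v z) ` U)"
    and "open ((\<lambda>z. q + R *v z) ` U)"
proof -
  have ot: "orthogonal_transformation ((*v) R)"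
    using R by (simp add: orthogonal_transformation_matrix)
  let ?V = "(*v) R ` U"
  have V: "open ?V"
    using U ot by (intro open_surjective_linear_image)
      (auto simp: orthogonal_transformation_linear orthogonal_transformation_surj)
  have eq: "(\<lambda>z. q + R *v z) ` U = (+) q ` ?V"
    by (simp add: image_image)
  show *: "open ((\<lambda>z. q + R *v z) ` U)"
    unfolding eq using V by (rule open_translation)
  \<comment> \<open>The translation is written as an affine map with factor 1 to match
    \<open>emeasure_lebesgue_affine\<close>.\<close>
  have eq1: "(\<lambda>z. q + R *v z) ` U = (\<lambda>x. 1 *\<^sub>R x + q) ` ?V"
    by (simp add: image_image add.commute)
  have "emeasure lborel U \<le> emeasure lborel ?V"
    using ot U by (rule emeasure_open_le_orthogonal_image)
  also have "\<dots> = emeasure lebesgue ?V"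
    using V by simp
  also have "\<dots> = emeasure lebesgue ((\<lambda>z. q + R *v z) ` U)"
    unfolding eq1 emeasure_lebesgue_affine by simp
  also have "\<dots> = emeasure lborel ((\<lambda>z. q + R *v z) ` U)"
    using * by simp
  finally show "emeasure lborel U \<le> emeasure lborel ((\<lambda>z. q + R *v z) ` U)" .
qed

text \<open>Each of the d coordinates collects an error \<epsilon> from the centre and at most
  \<epsilon> from each of d matrix entries, since the coordinates of \<open>z\<close> are at most 1
  in absolute value. The norm is at most the sum over the coordinates.\<close>

lemma norm_affine_diff_le:
  fixes R R' :: "real ^ 'n ^ 'n"
  assumes q: "\<And>i. \<bar>q $ i - q' $ i\<bar> \<le> \<epsilon>" and R: "\<And>i j. \<bar>R $ i $ j - R' $ i $ j\<bar> \<le> \<epsilon>"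
    and z: "norm z \<le> 1"
  shows "norm ((q + R *v z) - (q' + R' *v z)) \<le> real (CARD('n) + CARD('n) * CARD('n)) * \<epsilon>"
proof -
  have \<epsilon>: "0 \<le> \<epsilon>"
    \<comment> \<open>Any index serves: a bound on an absolute value is nonnegative.\<close>
    using q[of undefined] by linarith
  have comp: "\<bar>((q + R *v z) - (q' + R' *v z)) $ i\<bar> \<le> \<epsilon> + real CARD('n) * \<epsilon>" for i
  proof -
    have "((q + R *v z) - (q' + R' *v z)) $ i =
        (q $ i - q' $ i) + (\<Sum>j\<in>UNIV. (R $ i $ j - R' $ i $ j) * z $ j)"
      by (simp add: matrix_vector_mult_def left_diff_distrib sum_subtractf)
    moreover have "\<bar>\<Sum>j\<in>UNIV. (R $ i $ j - R' $ i $ j) * z $ j\<bar> \<le> (\<Sum>j\<in>(UNIV :: 'n set). \<epsilon>)"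
    proof (rule order_trans[OF sum_abs], rule sum_mono)
      fix j
      have "\<bar>z $ j\<bar> \<le> 1"
        using component_le_norm_cart[of z j] z by linarith
      then have "\<bar>R $ i $ j - R' $ i $ j\<bar> * \<bar>z $ j\<bar> \<le> \<epsilon> * 1"
        using R \<epsilon> by (intro mult_mono) auto
      then show "\<bar>(R $ i $ j - R' $ i $ j) * z $ j\<bar> \<le> \<epsilon>"
        by (simp add: abs_mult)
    qed
    ultimately show ?thesis
      using q[of i] by simp
  qed
  have "norm ((q + R *v z) - (q' + R' *v z)) \<le> (\<Sum>i\<in>(UNIV :: 'n set). \<epsilon> + real CARD('n) * \<epsilon>)"
    by (rule order_trans[OF norm_le_l1_cart], rule sum_mono) (rule comp)
  also have "\<dots> = real (CARD('n) + CARD('n) * CARD('n)) * \<epsilon>"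
    by (simp add: algebra_simps)
  finally show ?thesis .
qed

lemma orthogonal_matrix_inverse_mul:
  fixes R :: "real ^ 'n ^ 'n"
  assumes "orthogonal_matrix R"
  shows "R *v (transpose R *v x) = x" "transpose R *v (R *v x) = x"
  using assms by (simp_all add: orthogonal_matrix_def matrix_vector_mul_assoc del: transpose_matrix_vector)

lemma norm_orthogonal_matrix_mul:
  fixes R :: "real ^ 'n ^ 'n"
  assumes "orthogonal_matrix R"
  shows "norm (R *v x) = norm x"
  using assms orthogonal_transformation_norm[of "(*v) R"]
  by (simp add: orthogonal_transformation_matrix)

text \<open>Pull \<open>y\<close> back by the motion (\<open>q\<close>, \<open>R\<close>). As
  \<open>R\<close> is an isometry, the preimage is as far from \<open>z\<close> as the two images of
  \<open>z\<close> are from each other, which is within the tolerance of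
  \<open>inner_sector_perturb\<close>.\<close>

lemma inner_image_subset_moved_sector:
  fixes R R' :: "real ^ 'd::{finite,linorder} ^ 'd::{finite,linorder}"
  assumes r: "0 < r" "r \<le> 1" and \<delta>: "0 < \<delta>" "\<delta> < 1" and \<alpha>: "0 < \<alpha>" "\<alpha> < 1"
    and R: "orthogonal_matrix R"
    and q: "\<And>i. \<bar>q' $ i - q $ i\<bar> \<le> \<epsilon>" and R': "\<And>i j. \<bar>R' $ i $ j - R $ i $ j\<bar> \<le> \<epsilon>"
    and \<epsilon>: "real (CARD('d) + CARD('d) * CARD('d)) * \<epsilon> \<le> r * \<delta> * \<alpha> / 32"
  shows "(\<lambda>z. q' + R' *v z) ` inner_sector r \<delta> \<alpha> \<subseteq> moved_sector r \<delta> \<alpha> q R"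
proof
  fix y assume "y \<in> (\<lambda>z. q' + R' *v z) ` inner_sector r \<delta> \<alpha>"
  then obtain z where z: "z \<in> inner_sector r \<delta> \<alpha>" and y: "y = q' + R' *v z"
    by auto
  let ?w = "transpose R *v (y - q)"
  have "norm z < r * (1 - \<delta> / 4)"
    using z by (simp add: inner_sector_def)
  also have "\<dots> \<le> 1 * 1"
    using r \<delta> by (intro mult_mono) auto
  finally have "norm z \<le> 1"
    by simp
  have "?w - z = transpose R *v (y - q - R *v z)"
    using orthogonal_matrix_inverse_mul(2)[OF R, of z]
    by (simp add: matrix_vector_mult_diff_distrib del: transpose_matrix_vector)
  also have "y - q - R *v z = (q' + R' *v z) - (q + R *v z)"
    by (simp add: y)
  also have "norm (transpose R *v \<dots>) = norm ((q' + R' *v z) - (q + R *v z))"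
    using R by (intro norm_orthogonal_matrix_mul) simp
  also have "\<dots> \<le> r * \<delta> * \<alpha> / 32"
    using norm_affine_diff_le[OF q R' \<open>norm z \<le> 1\<close>] \<epsilon> by linarith
  finally have "?w \<in> shell_sector r \<delta> \<alpha>"
    by (rule inner_sector_perturb[OF r(1) \<delta> \<alpha> z])
  moreover have "y = q + R *v ?w"
    using R by (simp add: orthogonal_matrix_inverse_mul del: transpose_matrix_vector)
  ultimately show "y \<in> moved_sector r \<delta> \<alpha> q R"
    by (auto simp: moved_sector_def)
qed

section \<open>Finite nets of parameters\<close>

text \<open>Parameters are sorted into cells by rounding N times each entry down, which leaves at
  most 2BN + 1 integers per entry. One parameter is chosen from each occupied cell, so the net
  consists of members of \<open>P\<close> and inherits their properties.\<close>

lemma finite_grid_net: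
  fixes f :: "'a \<Rightarrow> 'i::finite \<Rightarrow> real" and B N :: nat
  assumes f: "\<And>p i. p \<in> P \<Longrightarrow> \<bar>f p i\<bar> \<le> B" and N: "0 < N"
  obtains T where "finite T" "T \<subseteq> P" "card T \<le> (2 * B * N + 1) ^ CARD('i)"
    "\<And>p. p \<in> P \<Longrightarrow> \<exists>t\<in>T. \<forall>i. \<bar>f t i - f p i\<bar> \<le> 1 / N"
proof
  define key where "key p i = \<lfloor>N * f p i\<rfloor>" for p i
  define T where "T = inv_into P key ` key ` P"
  have sub: "key ` P \<subseteq> Pi\<^sub>E UNIV (\<lambda>_. {- int (B * N)..int (B * N)})"
  proof (intro image_subsetI PiE_I)
    fix p i assume "p \<in> P"
    then have "\<bar>N * f p i\<bar> \<le> N * B"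
      using f[of p i] by (simp add: abs_mult mult_left_mono)
    then have "- (N * B) \<le> N * f p i" "N * f p i \<le> N * B"
      by linarith+
    then show "key p i \<in> {- int (B * N)..int (B * N)}"
      by (auto simp: key_def le_floor_iff floor_le_iff mult.commute)
  qed auto
  have fin: "finite (Pi\<^sub>E (UNIV :: 'i set) (\<lambda>_. {- int (B * N)..int (B * N)}))"
    by (intro finite_PiE) auto
  have "finite (key ` P)"
    using sub fin by (rule finite_subset)
  then show "finite T"
    by (simp add: T_def)
  show "T \<subseteq> P"
    by (auto simp: T_def inv_into_into)
  have "card T \<le> card (key ` P)"
    using \<open>finite (key ` P)\<close> by (simp add: T_def card_image_le)
  also have "\<dots> \<le> card (Pi\<^sub>E (UNIV :: 'i set) (\<lambda>_. {- int (B * N)..int (B * N)}))"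
    using fin sub by (rule card_mono)
  also have "\<dots> = (2 * B * N + 1) ^ CARD('i)"
    by (simp add: card_PiE nat_add_distrib nat_mult_distrib mult.assoc)
  finally show "card T \<le> (2 * B * N + 1) ^ CARD('i)" .
  fix p assume p: "p \<in> P"
  define t where "t = inv_into P key (key p)"
  have "t \<in> T"
    using p by (simp add: T_def t_def)
  moreover have "\<bar>f t i - f p i\<bar> \<le> 1 / N" for i
  proof -
    have "key t = key p"
      using p by (simp add: t_def f_inv_into_f)
    then have "\<lfloor>N * f t i\<rfloor> = \<lfloor>N * f p i\<rfloor>"
      unfolding key_def by (rule fun_cong)
    then have "\<bar>N * f t i - N * f p i\<bar> \<le> 1"
      by linarith
    then have "N * \<bar>f t i - f p i\<bar> \<le> 1"
      by (simp add: abs_mult flip: right_diff_distrib)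
    then show ?thesis
      using N by (simp add: field_simps)
  qed
  ultimately show "\<exists>t\<in>T. \<forall>i. \<bar>f t i - f p i\<bar> \<le> 1 / N"
    by blast
qed

section \<open>Probability that a sample misses a set\<close>

lemma prob_space_uniform_cube: "prob_space (restrict_space lborel (unit_cube :: (real ^ 'd) set))"
proof (rule prob_spaceI)
  have "emeasure lborel (unit_cube :: (real ^ 'd) set) = 1"
  proof -
    have "(\<Prod>b\<in>Basis. (1 - 0 :: real ^ 'd) \<bullet> b) = 1"
      by (rule prod.neutral) (auto simp: Basis_vec_def inner_axis)
    moreover have "(0 :: real ^ 'd) \<bullet> b \<le> 1 \<bullet> b" if "b \<in> Basis" for b
      using that by (auto simp: Basis_vec_def inner_axis)
    ultimately show ?thesis
      by (simp add: unit_cube_def emeasure_lborel_cbox_eq)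
  qed
  then show "emeasure (restrict_space lborel unit_cube)
      (space (restrict_space lborel (unit_cube :: (real ^ 'd) set))) = 1"
    by (subst emeasure_restrict_space) (auto simp: space_restrict_space unit_cube_def)
qed

lemma prob_space_sample_space: "prob_space sample_space"
  unfolding sample_space_def by (intro prob_space_PiM prob_space_uniform_cube)

text \<open>By independence the probability is the n-th power of the volume of the complement, and 1
  - v \<le> exp(-v).\<close>

lemma sample_space_avoid:
  fixes A :: "(real ^ 'd) set" and n :: nat and v :: real
  assumes A: "A \<in> sets borel" "A \<subseteq> unit_cube" and v: "ennreal v \<le> emeasure lborel A" "0 \<le> v"
  defines "E \<equiv> {\<omega> \<in> space sample_space. A \<inter> sample_points n \<omega> = {}}"
  shows "E \<in> sets sample_space" "measure sample_space E \<le> exp (- (n * v))"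
proof -
  let ?M = "restrict_space lborel (unit_cube :: (real ^ 'd) set)"
  interpret M: prob_space ?M
    by (rule prob_space_uniform_cube)
  interpret P: product_prob_space "\<lambda>_. ?M" "{1..} :: nat set"
    by unfold_locales
  have E: "E = {\<omega> \<in> space (Pi\<^sub>M {1..} (\<lambda>_. ?M)). \<forall>i\<in>{1..n}. \<omega> i \<in> unit_cube - A}"
    by (auto simp: E_def sample_space_def sample_points_def space_PiM PiE_iff space_restrict_space)
  have cube: "(unit_cube :: (real ^ 'd) set) \<in> sets borel"
    by (simp add: unit_cube_def)
  have AM: "A \<in> sets ?M" "unit_cube - A \<in> sets ?M"
    using A cube by (auto simp: sets_restrict_space_iff)
  have "emeasure lborel A = emeasure ?M A"
    using A cube by (simp add: emeasure_restrict_space)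
  then have "v \<le> measure ?M A"
    using v by (simp add: M.emeasure_eq_measure)
  moreover have "measure ?M (unit_cube - A) = 1 - measure ?M A"
    using M.prob_compl[OF AM(1)] by (simp add: space_restrict_space)
  ultimately have "measure ?M (unit_cube - A) \<le> 1 - v"
    by simp
  also have "\<dots> \<le> exp (- v)"
    using exp_ge_add_one_self[of "- v"] by simp
  finally have le: "measure ?M (unit_cube - A) \<le> exp (- v)" .
  have "emeasure (Pi\<^sub>M {1..} (\<lambda>_. ?M)) E = ennreal (measure ?M (unit_cube - A)) ^ n"
    unfolding E using AM by (subst P.emeasure_PiM_Collect) (auto simp: M.emeasure_eq_measure)
  then have "measure (Pi\<^sub>M {1..} (\<lambda>_. ?M)) E = measure ?M (unit_cube - A) ^ n"
    by (simp add: measure_def[of _ E] ennreal_power)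
  also have "\<dots> \<le> exp (- v) ^ n"
    using le by (intro power_mono) auto
  also have "\<dots> = exp (- (n * v))"
    by (simp add: exp_of_nat_mult[symmetric])
  finally show "measure sample_space E \<le> exp (- (n * v))"
    by (simp add: sample_space_def)
  have "{\<omega> \<in> space (Pi\<^sub>M {1..} (\<lambda>_. ?M)). \<forall>i\<in>{1..n}. \<omega> i \<in> unit_cube - A}
      \<in> sets (Pi\<^sub>M {1..} (\<lambda>_. ?M))"
    using AM by (intro sets.sets_Collect_finite_All sets_Collect_single) auto
  then show "E \<in> sets sample_space"
    unfolding E sample_space_def .
qed

section \<open>Union bound over all moved sectors\<close>

lemma abs_component_orthogonal_matrix_le:
  fixes R :: "real ^ 'n ^ 'n"
  assumes "orthogonal_matrix R"
  shows "\<bar>R $ i $ j\<bar> \<le> 1"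
proof -
  have "norm (column j R) = 1"
    using assms by (simp add: orthogonal_matrix_orthonormal_columns)
  then show ?thesis
    using component_le_norm_cart[of "column j R" i] by (simp add: column_def)
qed

lemma unit_cube_iff: "x \<in> unit_cube \<longleftrightarrow> (\<forall>i. 0 \<le> x $ i \<and> x $ i \<le> 1)"
  by (auto simp: unit_cube_def mem_box_cart)

text \<open>The axis point at the middle of the shell belongs to the sector and its image lies in
  the cube. The centre is within \<open>r \<le> 1\<close> of that image. This confines the centres
  to a bounded grid.\<close>

lemma moved_sector_centre_bound:
  fixes R :: "real ^ 'd::{finite,linorder} ^ 'd::{finite,linorder}"
  assumes r: "0 < r" "r \<le> 1" and \<delta>: "0 < \<delta>" "\<delta> < 1" and \<alpha>: "0 < \<alpha>"
    and R: "orthogonal_matrix R" and sub: "moved_sector r \<delta> \<alpha> q R \<subseteq> unit_cube"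
  shows "\<bar>q $ i\<bar> \<le> 2"
proof -
  define z :: "real ^ 'd::{finite,linorder}" where "z = (r * (1 - \<delta> / 2)) *\<^sub>R axis last_coord 1"
  have rd: "0 < r * \<delta>" "r * \<delta> < r"
    using r \<delta> by auto
  have nz: "norm z = r - r * \<delta> / 2"
    using rd by (simp add: z_def right_diff_distrib)
  have "transverse_norm z = 0"
    by (simp add: transverse_norm_def L2_set_def z_def axis_def)
  moreover have "0 \<le> z $ last_coord"
    using r \<delta> by (simp add: z_def)
  ultimately have "z \<in> shell_sector r \<delta> \<alpha>"
    using nz rd \<delta> \<alpha> by (simp add: shell_sector_def shell_def upward_cone_iff right_diff_distrib)
  then have "q + R *v z \<in> unit_cube"
    using sub by (auto simp: moved_sector_def)
  then have "0 \<le> q $ i + (R *v z) $ i" "q $ i + (R *v z) $ i \<le> 1"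
    by (auto simp: unit_cube_iff)
  moreover have "\<bar>(R *v z) $ i\<bar> \<le> norm z"
    using component_le_norm_cart[of "R *v z" i] R by (simp add: norm_orthogonal_matrix_mul)
  ultimately show ?thesis
    using nz rd r by linarith
qed

text \<open>\<open>E\<close> says that some member of the net has an empty inner image. Outside
  \<open>E\<close>, any admissible sector contains the inner image of a nearby net member, hence a
  sample point.\<close>

lemma empty_sector_event:
  fixes r \<delta> \<alpha> v :: real and n N :: nat
  assumes r: "0 < r" "r \<le> 1" and \<delta>: "0 < \<delta>" "\<delta> < 1" and \<alpha>: "0 < \<alpha>" "\<alpha> < 1"
    and v: "ennreal v \<le> emeasure lborel (inner_sector r \<delta> \<alpha> :: (real ^ 'd::{finite,linorder}) set)"
      "0 \<le> v"
    and N: "0 < N" "real (CARD('d) + CARD('d) * CARD('d)) / N \<le> r * \<delta> * \<alpha> / 32"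
  obtains E :: "(nat \<Rightarrow> real ^ 'd::{finite,linorder}) set" where "E \<in> sets sample_space"
    "measure sample_space E \<le> real (4 * N + 1) ^ (CARD('d) + CARD('d) * CARD('d)) * exp (- (n * v))"
    "\<And>\<omega> q R. \<omega> \<in> space sample_space - E \<Longrightarrow> rotation_matrix R \<Longrightarrow>
       moved_sector r \<delta> \<alpha> q R \<subseteq> unit_cube \<Longrightarrow> moved_sector r \<delta> \<alpha> q R \<inter> sample_points n \<omega> \<noteq> {}"
proof -
  let ?k = "CARD('d) + CARD('d) * CARD('d)"
  let ?I = "\<lambda>(q, R). (\<lambda>z. q + R *v z) ` (inner_sector r \<delta> \<alpha> :: (real ^ 'd::{finite,linorder}) set)"
  interpret S: prob_space "sample_space :: (nat \<Rightarrow> real ^ 'd::{finite,linorder}) measure"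
    by (rule prob_space_sample_space)
  define P where "P = {(q :: real ^ 'd::{finite,linorder}, R). orthogonal_matrix R \<and>
    moved_sector r \<delta> \<alpha> q R \<subseteq> unit_cube}"
  \<comment> \<open>A motion is flattened into its real entries, indexed by a sum type of
    cardinality d + d^2; this is the exponent in the bound. All entries are at most 2 in absolute
    value, whence the base 4N + 1.\<close>
  define f where "f = (\<lambda>(q :: real ^ 'd::{finite,linorder}, R :: real ^ 'd::{finite,linorder} ^ 'd::{finite,linorder}).
    case_sum (\<lambda>i. q $ i) (\<lambda>(i, j). R $ i $ j))"
  have "\<bar>f p i\<bar> \<le> real 2" if p: "p \<in> P" for p i
  proof -
    obtain q R where pq: "p = (q, R)" "orthogonal_matrix R" "moved_sector r \<delta> \<alpha> q R \<subseteq> unit_cube"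
      using p by (auto simp: P_def)
    show ?thesis
    proof (cases i)
      case (Inl i')
      then show ?thesis
        using moved_sector_centre_bound[OF r \<delta> \<alpha>(1) pq(2,3)] by (simp add: f_def pq(1))
    next
      case (Inr ij)
      then show ?thesis
        using abs_component_orthogonal_matrix_le[OF pq(2), of "fst ij" "snd ij"]
        by (simp add: f_def pq(1) split_beta)
    qed
  qed
  then obtain T where T: "finite T" "T \<subseteq> P"
    and card_T: "card T \<le> (2 * 2 * N + 1) ^ CARD('d + 'd \<times> 'd)"
    and net: "\<And>p. p \<in> P \<Longrightarrow> \<exists>t\<in>T. \<forall>i. \<bar>f t i - f p i\<bar> \<le> 1 / N"
    using finite_grid_net[of P f 2 N] N(1) by metis
  define E where "E = (\<Union>t\<in>T. {\<omega> \<in> space sample_space. ?I t \<inter> sample_points n \<omega> = {}})"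
  have cover: "?I t \<subseteq> moved_sector r \<delta> \<alpha> q R"
    if "orthogonal_matrix R" "\<forall>i. \<bar>f t i - f (q, R) i\<bar> \<le> 1 / N" for t q R
  proof -
    obtain q' R' where t: "t = (q', R')"
      by fastforce
    have "\<bar>q' $ i - q $ i\<bar> \<le> 1 / N" "\<bar>R' $ i $ j - R $ i $ j\<bar> \<le> 1 / N" for i j
      using that(2)[THEN spec, of "Inl i"] that(2)[THEN spec, of "Inr (i, j)"]
      by (auto simp: f_def t)
    from inner_image_subset_moved_sector[OF r \<delta> \<alpha> that(1) this] show ?thesis
      using N(2) by (simp add: t)
  qed
  have single: "{\<omega> \<in> space sample_space. ?I t \<inter> sample_points n \<omega> = {}} \<in> sets sample_space \<and>
      measure sample_space {\<omega> \<in> space sample_space. ?I t \<inter> sample_points n \<omega> = {}} \<le> exp (- (n * v))"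
    if "t \<in> T" for t
  proof -
    have tP: "t \<in> P"
      using T(2) that by blast
    obtain q R where t: "t = (q, R)" "orthogonal_matrix R" "moved_sector r \<delta> \<alpha> q R \<subseteq> unit_cube"
      using tP by (auto simp: P_def)
    have "open (?I t)" and le: "emeasure lborel (inner_sector r \<delta> \<alpha> :: (real ^ 'd::{finite,linorder}) set)
        \<le> emeasure lborel (?I t)"
      using emeasure_open_le_rigid_image[OF t(2) open_inner_sector] by (simp_all add: t(1))
    then have "?I t \<in> sets borel"
      by simp
    moreover have "?I t \<subseteq> moved_sector r \<delta> \<alpha> q R"
      \<comment> \<open>The covering fact is applied to \<open>t\<close> and itself: the inner image
        lies in its own sector, hence in the cube.\<close>
      by (rule cover[OF t(2)]) (simp add: t(1))
    moreover have "ennreal v \<le> emeasure lborel (?I t)"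
      using v(1) le by (rule order_trans)
    ultimately show ?thesis
      using sample_space_avoid[of "?I t" v n] v(2) t(3) by blast
  qed
  show thesis
  proof (rule that)
    show "E \<in> sets sample_space"
      unfolding E_def using single T(1) by (intro sets.finite_UN) auto
    have "measure sample_space E \<le>
        (\<Sum>t\<in>T. measure sample_space {\<omega> \<in> space sample_space. ?I t \<inter> sample_points n \<omega> = {}})"
      unfolding E_def using single T(1) by (intro S.finite_measure_subadditive_finite) auto
    also have "\<dots> \<le> (\<Sum>t\<in>T. exp (- (n * v)))"
      using single by (intro sum_mono) auto
    also have "\<dots> = real (card T) * exp (- (n * v))"
      by simp
    also have "\<dots> \<le> real (4 * N + 1) ^ ?k * exp (- (n * v))"
    proof (intro mult_right_mono)
      have "card T \<le> (4 * N + 1) ^ ?k"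
        using card_T by simp
      then show "real (card T) \<le> real (4 * N + 1) ^ ?k"
        using of_nat_mono[of "card T" "(4 * N + 1) ^ ?k", where 'a = real] by simp
    qed simp
    finally show "measure sample_space E \<le> real (4 * N + 1) ^ ?k * exp (- (n * v))" .
  next
    fix \<omega> :: "nat \<Rightarrow> real ^ 'd::{finite,linorder}" and q :: "real ^ 'd::{finite,linorder}" and R
    assume \<omega>: "\<omega> \<in> space sample_space - E" and R: "rotation_matrix R"
      and sub: "moved_sector r \<delta> \<alpha> q R \<subseteq> unit_cube"
    have R': "orthogonal_matrix R"
      using R by (simp add: rotation_matrix_def)
    then have "(q, R) \<in> P"
      using sub by (simp add: P_def)
    then obtain t where t: "t \<in> T" "\<forall>i. \<bar>f t i - f (q, R) i\<bar> \<le> 1 / N"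
      using net by blast
    have "?I t \<inter> sample_points n \<omega> \<noteq> {}"
      using \<omega> t(1) by (auto simp: E_def)
    then show "moved_sector r \<delta> \<alpha> q R \<inter> sample_points n \<omega> \<noteq> {}"
      using cover[OF R' t(2)] by blast
  qed
qed

section \<open>Rotations at a point of the cube, and neighbours in the graph\<close>

text \<open>The axis turns to \<open>u\<close>, whose coordinates have size 1/sqrt d and point to
  the farther face in each direction. A sector point at height \<open>t\<close> deviates from t u by
  at most \<alpha>t \<le> t/sqrt d, so no coordinate changes sign, and none moves by more than r
  \<le> 1/2.\<close>

lemma rotation_pointing_into_cube:
  fixes x :: "real ^ 'd::{finite,linorder}"
  assumes dim: "2 \<le> CARD('d)" and x: "x \<in> unit_cube" and r: "r \<le> 1 / 2"
    and \<alpha>: "0 < \<alpha>" "\<alpha> \<le> 1 / sqrt (real CARD('d))"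
  obtains R where "rotation_matrix R" "moved_sector r \<delta> \<alpha> x R \<subseteq> unit_cube"
proof -
  define s where "s i = (if x $ i \<le> 1 / 2 then 1 else - 1 :: real)" for i
  let ?D = "sqrt (real CARD('d))"
  define u :: "real ^ 'd::{finite,linorder}" where "u = (\<chi> i. s i / ?D)"
  have s2: "(s i)\<^sup>2 = 1" for i
    by (simp add: s_def)
  have "norm u = 1"
    by (simp add: norm_vec_def L2_set_def u_def power_divide s2)
  then have "norm (axis last_coord 1 :: real ^ 'd::{finite,linorder}) = norm u"
    by simp
  then obtain f where f: "orthogonal_transformation f" "det (matrix f) = 1"
    and fu: "f (axis last_coord 1) = u"
    using rotation_exists[OF dim] by blast
  have lf: "linear f"
    using f(1) by (rule orthogonal_transformation_linear)
  have mf: "matrix f *v z = f z" for z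
    using lf by simp
  show thesis
  proof (rule that)
    show "rotation_matrix (matrix f)"
      using f by (simp add: rotation_matrix_def orthogonal_transformation_matrix)
    show "moved_sector r \<delta> \<alpha> x (matrix f) \<subseteq> unit_cube"
    proof
      fix y assume "y \<in> moved_sector r \<delta> \<alpha> x (matrix f)"
      then obtain z where z: "z \<in> shell_sector r \<delta> \<alpha>" and y: "y = x + f z"
        by (auto simp: moved_sector_def mf)
      define t where "t = z $ last_coord"
      have cone: "transverse_norm z \<le> \<alpha> * t" and nz: "norm z < r"
        using z by (auto simp: shell_sector_def shell_def upward_cone_iff t_def)
      then have "0 \<le> \<alpha> * t"
        using transverse_norm_nonneg[of z] by linarith
      then have t: "0 \<le> t"
        using \<alpha> by (simp add: zero_le_mult_iff)
      \<comment> \<open>The part of \<open>z\<close> orthogonal to the axis; its norm is the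
        transverse norm of \<open>z\<close>.\<close>
      define z' where "z' = z - t *\<^sub>R axis last_coord 1"
      have "transverse_norm z' = transverse_norm z"
        unfolding transverse_norm_def by (rule L2_set_cong) (auto simp: z'_def axis_def)
      moreover have "z' $ last_coord = 0"
        by (simp add: z'_def t_def)
      ultimately have nz': "norm z' \<le> \<alpha> * t"
        using norm_le_transverse_norm_plus[of z'] cone by simp
      have fz: "f z = t *\<^sub>R u + f z'"
        using lf by (simp add: z'_def linear_diff linear_scale fu)
      have "0 \<le> y $ i \<and> y $ i \<le> 1" for i
      proof -
        have A: "\<bar>f z $ i\<bar> \<le> 1 / 2"
          using component_le_norm_cart[of "f z" i] f(1) nz r
          by (simp add: orthogonal_transformation_norm)
        have "\<bar>f z' $ i\<bar> \<le> \<alpha> * t"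
          using component_le_norm_cart[of "f z'" i] f(1) nz'
          by (simp add: orthogonal_transformation_norm)
        also have "\<dots> \<le> t / ?D"
          using mult_right_mono[OF \<alpha>(2) t] by simp
        finally have B: "\<bar>f z' $ i\<bar> \<le> t / ?D" .
        have C: "0 \<le> x $ i" "x $ i \<le> 1"
          using x by (auto simp: unit_cube_iff)
        have D: "y $ i = x $ i + f z $ i"
          by (simp add: y)
        have "x $ i \<le> 1 / 2 \<and> f z $ i = t / ?D + f z' $ i \<or>
            1 / 2 < x $ i \<and> f z $ i = - (t / ?D) + f z' $ i"
          by (auto simp: s_def fz u_def)
        then show ?thesis
          by (elim disjE conjE) (use A B C D in linarith)+
      qed
      then show "y \<in> unit_cube"
        by (simp add: unit_cube_iff)
    qed
  qed
qed

lemma geom_component_subset: "C \<in> geom_components r V \<Longrightarrow> C \<subseteq> V"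
proof -
  have "(x, y) \<in> (geom_edges r V)\<^sup>* \<Longrightarrow> x \<in> V \<Longrightarrow> y \<in> V" for x y
    by (induction rule: rtrancl_induct) (auto simp: geom_edges_def)
  then show "C \<in> geom_components r V \<Longrightarrow> C \<subseteq> V"
    by (auto simp: geom_components_def)
qed

text \<open>Rotating about \<open>x\<close> preserves distances to \<open>x\<close>, so the shell
  bounds become the bounds on the distance; a positive inner radius excludes \<open>x\<close>
  itself.\<close>

lemma moved_sector_outer_neighbours:
  assumes "0 < r" "\<delta> < 1" "orthogonal_matrix R" "x \<in> V"
  shows "moved_sector r \<delta> \<alpha> x R \<inter> V \<subseteq> outer_neighbours r \<delta> V x"
proof
  fix y assume "y \<in> moved_sector r \<delta> \<alpha> x R \<inter> V"
  then obtain z where z: "r * (1 - \<delta>) < norm z" "norm z < r" and y: "y = x + R *v z" "y \<in> V"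
    by (auto simp: moved_sector_def shell_sector_def shell_def)
  have "dist x y = norm z"
    using assms(3) by (simp add: y(1) dist_norm norm_orthogonal_matrix_mul)
  moreover have "0 < r * (1 - \<delta>)"
    using assms by simp
  then have "x \<noteq> y"
    using calculation z by auto
  ultimately show "y \<in> outer_neighbours r \<delta> V x"
    using z y(2) assms(4)
    by (simp add: outer_neighbours_def neighbours_def geom_edges_def mult.commute)
qed

section \<open>Asymptotic estimates\<close>

text \<open>The polynomial is at most exp(2k ln n) and the exponential equals exp(-c sqrt n ln n).
  Once c sqrt n \<ge> 2k + 2, the product is at most n^(-2), which is summable.\<close>

lemma eventually_net_bound:
  fixes c :: real and k :: nat
  assumes c: "0 < c"
  shows "\<forall>\<^sub>F n in sequentially.
    real (4 * n + 1) ^ k * exp (- (real n * (c * ln (real n) / sqrt (real n)))) \<le> 1 / (real n)\<^sup>2"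
proof -
  have "\<forall>\<^sub>F n in sequentially. (2 * real k + 2) / c \<le> sqrt (real n)"
    using filterlim_compose[OF sqrt_at_top filterlim_real_sequentially]
    by (simp add: filterlim_at_top)
  moreover have "\<forall>\<^sub>F n :: nat in sequentially. 5 \<le> n"
    by (rule eventually_ge_at_top)
  ultimately show ?thesis
  proof eventually_elim
    case (elim n)
    let ?L = "ln (real n)"
    have L: "0 \<le> ?L"
      using elim by simp
    have "4 * n + 1 \<le> 5 * n" "5 * n \<le> n * n"
      using elim by auto
    then have "4 * n + 1 \<le> n\<^sup>2"
      unfolding power2_eq_square by linarith
    then have "real (4 * n + 1) ^ k \<le> real (n\<^sup>2) ^ k"
      by (intro power_mono of_nat_mono) auto
    also have "\<dots> = exp ?L ^ (2 * k)"
      using elim by (simp add: power_mult)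
    also have "\<dots> = exp (2 * real k * ?L)"
      by (simp flip: exp_of_nat_mult)
    finally have A: "real (4 * n + 1) ^ k \<le> exp (2 * real k * ?L)" .
    have "real n / sqrt (real n) = sqrt (real n)"
      by (simp add: real_div_sqrt)
    then have "real n * (c * ?L / sqrt (real n)) = c * sqrt (real n) * ?L"
      by (metis mult.assoc mult.commute times_divide_eq_left)
    moreover have "2 * real k + 2 \<le> c * sqrt (real n)"
      using elim(1) c by (simp add: divide_le_eq mult.commute)
    then have "(2 * real k + 2) * ?L \<le> c * sqrt (real n) * ?L"
      using L by (rule mult_right_mono)
    ultimately have B: "exp (- (real n * (c * ?L / sqrt (real n)))) \<le> exp (- ((2 * real k + 2) * ?L))"
      by simp
    have "real (4 * n + 1) ^ k * exp (- (real n * (c * ?L / sqrt (real n)))) \<le>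
        exp (2 * real k * ?L) * exp (- ((2 * real k + 2) * ?L))"
      using A B by (intro mult_mono) auto
    also have "\<dots> = exp (- ?L) ^ 2"
      by (simp add: algebra_simps flip: exp_add exp_of_nat_mult)
    also have "\<dots> = 1 / (real n)\<^sup>2"
      using elim by (simp add: exp_minus power_inverse inverse_eq_divide power_divide)
    finally show ?case .
  qed
qed

text \<open>As \<open>ln\<close> is unbounded, b ln n eventually exceeds C; dividing by sqrt n
  instead of n only enlarges the right-hand side.\<close>

lemma eventually_mesh_bound:
  fixes b C :: real
  assumes b: "0 < b"
  shows "\<forall>\<^sub>F n in sequentially. C / real n \<le> b * ln (real n) / sqrt (real n)"
proof -
  have "filterlim (\<lambda>n. ln (real n)) at_top sequentially"
    by (rule filterlim_compose[OF ln_at_top filterlim_real_sequentially])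
  then have "\<forall>\<^sub>F n in sequentially. \<bar>C\<bar> / b \<le> ln (real n)"
    by (simp add: filterlim_at_top)
  moreover have "\<forall>\<^sub>F n :: nat in sequentially. 1 \<le> n"
    by (rule eventually_ge_at_top)
  ultimately show ?thesis
  proof eventually_elim
    case (elim n)
    have "C \<le> b * ln (real n)"
      using elim(1) b by (simp add: divide_le_eq mult.commute)
    then have "C / real n \<le> b * ln (real n) / real n"
      by (intro divide_right_mono) auto
    also have "\<dots> \<le> b * ln (real n) / sqrt (real n)"
    proof (rule divide_left_mono)
      show "sqrt (real n) \<le> real n"
        using elim(2) by (intro real_le_lsqrt) (auto simp: power2_eq_square)
    qed (use elim b in auto)
    finally show ?case .
  qed
qed

section \<open>Borel-Cantelli and the conclusions for the graph\<close>

theorem lemma1: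
  fixes r \<delta> \<alpha> :: "nat \<Rightarrow> real"
  assumes dim: "CARD('d::{finite,linorder}) \<ge> 2"
    and r_pos: "\<forall>n\<ge>1. r n > 0"
    and r_decreasing: "antimono_on {1..} r"
    and r_lim: "r \<longlonglongrightarrow> 0"
    and \<delta>_range: "\<forall>n\<ge>1. \<delta> n \<in> {0<..<1}"
    and \<delta>_decreasing: "antimono_on {1..} \<delta>"
    and \<delta>_lim: "\<delta> \<longlonglongrightarrow> 0"
    and \<alpha>_range: "\<forall>n\<ge>1. \<alpha> n \<in> {0<..<1}"
    and \<alpha>_lim: "\<alpha> \<longlonglongrightarrow> 0"
    and growth: "\<forall>n\<ge>2. sector_const TYPE('d) * sqrt (real n) * r n ^ CARD('d) * \<delta> n
                          * \<alpha> n ^ (CARD('d) - 1) / ln (real n) \<ge> 2"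
  shows "AE \<omega> in (sample_space :: (nat \<Rightarrow> real ^ 'd::{finite,linorder}) measure). \<exists>n\<^sub>0. \<forall>n\<ge>n\<^sub>0.
           (\<forall>A \<in> sector_family (r n) (\<delta> n) (\<alpha> n). A \<inter> sample_points n \<omega> \<noteq> {}) \<and>
           (\<forall>C. largest_component (r n) (sample_points n \<omega>) C \<longrightarrow>
              (\<forall>x\<in>C.
                 (\<forall>R. rotation_matrix R \<and> moved_sector (r n) (\<delta> n) (\<alpha> n) x R \<subseteq> unit_cube \<longrightarrow>
                    moved_sector (r n) (\<delta> n) (\<alpha> n) x R
                      \<inter> outer_neighbours (r n) (\<delta> n) (sample_points n \<omega>) x \<noteq> {}) \<and>
                 outer_neighbours (r n) (\<delta> n) (sample_points n \<omega>) x \<noteq> {}))"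
proof -
  let ?d = "CARD('d)"
  let ?k = "?d + ?d * ?d"
  let ?M = "sample_space :: (nat \<Rightarrow> real ^ 'd::{finite,linorder}) measure"
  interpret S: prob_space ?M
    by (rule prob_space_sample_space)
  define b where "b = sector_const TYPE('d)"
  define w where "w n = r n ^ ?d * \<delta> n * \<alpha> n ^ (?d - 1)" for n
  have rg: "0 < r n" "0 < \<delta> n" "\<delta> n < 1" "0 < \<alpha> n" "\<alpha> n < 1" if "1 \<le> n" for n
    using that r_pos \<delta>_range \<alpha>_range by auto
  have w_pos: "0 < w n" if "1 \<le> n" for n
    using rg[OF that] by (simp add: w_def)
  have gr: "2 * ln (real n) \<le> b * sqrt (real n) * w n" if "2 \<le> n" for n
  proof -
    have "0 < ln (real n)"
      using that by simp
    moreover have "2 \<le> b * sqrt (real n) * w n / ln (real n)"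
      using growth that by (simp add: b_def w_def mult.assoc)
    ultimately show ?thesis
      by (simp add: le_divide_eq)
  qed
  \<comment> \<open>Positivity follows from the growth condition alone, whatever the definite description
    in the definition of \<open>sector_const\<close> denotes.\<close>
  have b: "0 < b"
  proof -
    have "0 < 2 * ln (real 2)"
      by simp
    also have "\<dots> \<le> b * sqrt (real 2) * w 2"
      by (rule gr) simp
    finally show ?thesis
      using w_pos[of 2] by (simp add: zero_less_mult_iff)
  qed
  \<comment> \<open>The growth condition solved for \<open>w n\<close>, the model volume without its
    constant.\<close>
  have w_ge: "2 / b * ln (real n) / sqrt (real n) \<le> w n" if "2 \<le> n" for n
    using gr[OF that] that b by (simp add: field_simps)
  obtain c where c: "0 < c" and c_vol: "\<And>r \<delta> \<alpha>. 0 < r \<Longrightarrow> 0 < \<delta> \<Longrightarrow> \<delta> < 1 \<Longrightarrow> 0 < \<alpha> \<Longrightarrow> \<alpha> < 1 \<Longrightarrow>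
      ennreal (c * r ^ ?d * \<delta> * \<alpha> ^ (?d - 1)) \<le>
        emeasure lborel (inner_sector r \<delta> \<alpha> :: (real ^ 'd::{finite,linorder}) set)"
    using emeasure_inner_sector_ge[where 'd = 'd] by metis
  \<comment> \<open>The lower bound for the volume of the inner sector that results from
    \<open>c_vol\<close> and \<open>w_ge\<close>.\<close>
  define v where "v n = c * (2 / b) * ln (real n) / sqrt (real n)" for n :: nat
  \<comment> \<open>Collects what holds only for large \<open>n\<close>: room for the rotation at a
    sample point, a mesh 1/n fine enough for the perturbation, and a summable probability
    bound.\<close>
  define good where "good n \<longleftrightarrow> 2 \<le> n \<and> r n \<le> 1 / 2 \<and> \<alpha> n \<le> 1 / sqrt (real ?d) \<and>
      real ?k / real n \<le> 2 / b / 32 * ln (real n) / sqrt (real n) \<and>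
      real (4 * n + 1) ^ ?k * exp (- (real n * v n)) \<le> 1 / (real n)\<^sup>2" for n
  have ev_good: "\<forall>\<^sub>F n in sequentially. good n"
    unfolding good_def v_def
  proof (intro eventually_conj)
    show "\<forall>\<^sub>F n in sequentially. 2 \<le> n"
      by (rule eventually_ge_at_top)
    show "\<forall>\<^sub>F n in sequentially. r n \<le> 1 / 2"
      using order_tendstoD(2)[OF r_lim, of "1 / 2"] by (auto elim: eventually_mono)
    show "\<forall>\<^sub>F n in sequentially. \<alpha> n \<le> 1 / sqrt (real ?d)"
      using order_tendstoD(2)[OF \<alpha>_lim, of "1 / sqrt (real ?d)"] by (auto elim: eventually_mono)
    show "\<forall>\<^sub>F n in sequentially. real ?k / real n \<le> 2 / b / 32 * ln (real n) / sqrt (real n)"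
      using b by (intro eventually_mesh_bound) simp
    show "\<forall>\<^sub>F n in sequentially.
        real (4 * n + 1) ^ ?k * exp (- (real n * (c * (2 / b) * ln (real n) / sqrt (real n)))) \<le> 1 / (real n)\<^sup>2"
      using b c by (intro eventually_net_bound) simp
  qed
  \<comment> \<open>Only the hitting property is conditional on \<open>good n\<close>, so that one
    sequence of events with summable probabilities can be chosen for all \<open>n\<close>.\<close>
  have "\<exists>E. E \<in> sets ?M \<and> measure ?M E \<le> 1 / (real n)\<^sup>2 \<and>
      (good n \<longrightarrow> (\<forall>\<omega>\<in>space ?M - E. \<forall>q R. rotation_matrix R \<longrightarrow>
         moved_sector (r n) (\<delta> n) (\<alpha> n) q R \<subseteq> unit_cube \<longrightarrow>
         moved_sector (r n) (\<delta> n) (\<alpha> n) q R \<inter> sample_points n \<omega> \<noteq> {}))" for n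
  proof (cases "good n")
    case True
    then have n: "2 \<le> n" "1 \<le> n" and rn: "r n \<le> 1" "r n \<le> 1 / 2"
      by (auto simp: good_def)
    note rgn = rg[OF n(2)]
    have "v n = c * (2 / b * ln (real n) / sqrt (real n))"
      by (simp add: v_def)
    also have "\<dots> \<le> c * w n"
      using w_ge[OF n(1)] c by (intro mult_left_mono) auto
    finally have "v n \<le> c * r n ^ ?d * \<delta> n * \<alpha> n ^ (?d - 1)"
      by (simp add: w_def mult.assoc)
    then have v: "ennreal (v n) \<le>
        emeasure lborel (inner_sector (r n) (\<delta> n) (\<alpha> n) :: (real ^ 'd::{finite,linorder}) set)"
      using c_vol[OF rgn] ennreal_leI order_trans by blast
    have v0: "0 \<le> v n"
      using b c n by (simp add: v_def)
    \<comment> \<open>Since d \<ge> 2, both exponents are at least 1 and the bases are at most 1. So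
      the lower bound on \<open>w n\<close> is also one on r\<delta>\<alpha>, the quantity compared
      with the mesh.\<close>
    have "r n ^ ?d \<le> r n" "\<alpha> n ^ (?d - 1) \<le> \<alpha> n"
      using rgn rn dim power_decreasing[of 1 ?d "r n"] power_decreasing[of 1 "?d - 1" "\<alpha> n"]
      by auto
    then have w_le: "w n \<le> r n * \<delta> n * \<alpha> n"
      unfolding w_def using rgn by (intro mult_mono) auto
    have "real ?k / real n \<le> 2 / b / 32 * ln (real n) / sqrt (real n)"
      using True unfolding good_def by blast
    also have "\<dots> = (2 / b * ln (real n) / sqrt (real n)) / 32"
      by simp
    also have "\<dots> \<le> w n / 32"
      using w_ge[OF n(1)] by (rule divide_right_mono) simp
    also have "\<dots> \<le> r n * \<delta> n * \<alpha> n / 32"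
      using w_le by (rule divide_right_mono) simp
    finally have mesh: "real ?k / real n \<le> r n * \<delta> n * \<alpha> n / 32" .
    have "0 < n"
      using n by simp
    show ?thesis
    proof (rule empty_sector_event[OF rgn(1) rn(1) rgn(2-5) v v0 \<open>0 < n\<close> mesh, of n])
      fix E
      assume E: "E \<in> sets ?M"
        and "measure ?M E \<le> real (4 * n + 1) ^ ?k * exp (- (real n * v n))"
        and hit: "\<And>\<omega> q R. \<omega> \<in> space ?M - E \<Longrightarrow> rotation_matrix R \<Longrightarrow>
          moved_sector (r n) (\<delta> n) (\<alpha> n) q R \<subseteq> unit_cube \<Longrightarrow>
          moved_sector (r n) (\<delta> n) (\<alpha> n) q R \<inter> sample_points n \<omega> \<noteq> {}"
      note this(2)
      also have "real (4 * n + 1) ^ ?k * exp (- (real n * v n)) \<le> 1 / (real n)\<^sup>2"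
        using True unfolding good_def by blast
      finally have "measure ?M E \<le> 1 / (real n)\<^sup>2" .
      then show ?thesis
        using E hit by (intro exI[of _ E] conjI impI ballI allI)
    qed
  \<comment> \<open>When \<open>good n\<close> fails, the empty event will do; at
    \<open>n = 0\<close> the bound is 0, as division by zero yields 0.\<close>
  qed (auto intro!: exI[of _ "{}"])
  then obtain E where E: "\<And>n. E n \<in> sets ?M" "\<And>n. measure ?M (E n) \<le> 1 / (real n)\<^sup>2"
    and hit: "\<And>n \<omega> q R. good n \<Longrightarrow> \<omega> \<in> space ?M - E n \<Longrightarrow> rotation_matrix R \<Longrightarrow>
         moved_sector (r n) (\<delta> n) (\<alpha> n) q R \<subseteq> unit_cube \<Longrightarrow>
         moved_sector (r n) (\<delta> n) (\<alpha> n) q R \<inter> sample_points n \<omega> \<noteq> {}"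
    by metis
  have "summable (\<lambda>n. measure ?M (E n))"
  proof (rule summable_comparison_test')
    show "summable (\<lambda>n. 1 / (real n)\<^sup>2)"
      using inverse_power_summable[of 2, where 'a = real] by (simp add: inverse_eq_divide)
  qed (use E in auto)
  then have "AE \<omega> in ?M. \<forall>\<^sub>F n in sequentially. \<omega> \<in> space ?M - E n"
    using E(1) by (intro borel_cantelli_AE1) (auto simp: S.emeasure_eq_measure)
  then show ?thesis
  proof (rule AE_mp, intro AE_I2 impI)
    fix \<omega> assume \<omega>_space: "\<omega> \<in> space ?M" and "\<forall>\<^sub>F n in sequentially. \<omega> \<in> space ?M - E n"
    then have "\<forall>\<^sub>F n in sequentially. \<omega> \<in> space ?M - E n \<and> good n"
      using ev_good by (simp add: eventually_conj_iff)
    then obtain n\<^sub>0 where n\<^sub>0: "\<And>n. n\<^sub>0 \<le> n \<Longrightarrow> \<omega> \<in> space ?M - E n \<and> good n"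
      unfolding eventually_sequentially by blast
    show "\<exists>n\<^sub>0. \<forall>n\<ge>n\<^sub>0.
           (\<forall>A \<in> sector_family (r n) (\<delta> n) (\<alpha> n). A \<inter> sample_points n \<omega> \<noteq> {}) \<and>
           (\<forall>C. largest_component (r n) (sample_points n \<omega>) C \<longrightarrow>
              (\<forall>x\<in>C.
                 (\<forall>R. rotation_matrix R \<and> moved_sector (r n) (\<delta> n) (\<alpha> n) x R \<subseteq> unit_cube \<longrightarrow>
                    moved_sector (r n) (\<delta> n) (\<alpha> n) x R
                      \<inter> outer_neighbours (r n) (\<delta> n) (sample_points n \<omega>) x \<noteq> {}) \<and>
                 outer_neighbours (r n) (\<delta> n) (sample_points n \<omega>) x \<noteq> {}))"
    proof (intro exI[of _ n\<^sub>0] allI impI conjI ballI)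
      fix n assume n: "n\<^sub>0 \<le> n"
      note gn = n\<^sub>0[OF n, THEN conjunct2]
      \<comment> \<open>The centre \<open>q\<close> is an arbitrary real vector, so this covers both
        the rational centres of \<open>sector_family\<close> and the sample points
        themselves.\<close>
      have hit_n: "moved_sector (r n) (\<delta> n) (\<alpha> n) q R \<inter> sample_points n \<omega> \<noteq> {}"
        if "rotation_matrix R" "moved_sector (r n) (\<delta> n) (\<alpha> n) q R \<subseteq> unit_cube" for q R
        using hit[OF gn n\<^sub>0[OF n, THEN conjunct1] that] .
      show "A \<inter> sample_points n \<omega> \<noteq> {}" if "A \<in> sector_family (r n) (\<delta> n) (\<alpha> n)" for A
        using that hit_n by (auto simp: sector_family_def)
      fix C x assume "largest_component (r n) (sample_points n \<omega>) C" and "x \<in> C"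
      then have x: "x \<in> sample_points n \<omega>"
        using geom_component_subset by (fastforce simp: largest_component_def is_arg_max_def)
      then have x_cube: "x \<in> unit_cube"
        using \<omega>_space by (auto simp: sample_points_def sample_space_def space_PiM space_restrict_space)
      have n1: "1 \<le> n"
        using gn by (simp add: good_def)
      have outer: "moved_sector (r n) (\<delta> n) (\<alpha> n) x R
          \<inter> outer_neighbours (r n) (\<delta> n) (sample_points n \<omega>) x \<noteq> {}"
        if "rotation_matrix R" "moved_sector (r n) (\<delta> n) (\<alpha> n) x R \<subseteq> unit_cube" for R
        using hit_n[OF that] moved_sector_outer_neighbours[OF rg(1,3)[OF n1] _ x, of R "\<alpha> n"] that(1)
        by (auto simp: rotation_matrix_def)
      then show "moved_sector (r n) (\<delta> n) (\<alpha> n) x R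
          \<inter> outer_neighbours (r n) (\<delta> n) (sample_points n \<omega>) x \<noteq> {}"
        if "rotation_matrix R \<and> moved_sector (r n) (\<delta> n) (\<alpha> n) x R \<subseteq> unit_cube" for R
        using that by blast
      \<comment> \<open>Nonemptiness needs at least one admissible direction at \<open>x\<close>,
        including when \<open>x\<close> is near the boundary of the cube.\<close>
      obtain R where "rotation_matrix R" "moved_sector (r n) (\<delta> n) (\<alpha> n) x R \<subseteq> unit_cube"
        using rotation_pointing_into_cube[OF dim x_cube, of "r n" "\<alpha> n" "\<delta> n"] rg(4)[OF n1] gn
        by (auto simp: good_def)
      then show "outer_neighbours (r n) (\<delta> n) (sample_points n \<omega>) x \<noteq> {}"
        using outer by blast
    qed
  qed
qed

end
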